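(* Let $f:X\to Y$ be a continuous surjective map between Tychonoff spaces $X$ and $Y$. Then the following assertions are equivalent: (i) $f$ is a $\kappa$-pseudo open map; (ii) $\overline{U}=f\big(\overline{f^{-1}(U)}\big)$ for any open $U\subseteq Y$; (iii) $f^{-1}(y)\cap\overline{f^{-1}(U)}\neq\emptyset$ for every open non-closed set $U\subseteq Y$ and each $y\in\overline{U}\setminus U$.
   Context: All topological spaces are assumed to be Tychonoff. A map $f:X\to Y$ is called $\kappa$-pseudo open if whenever $y\in Y$, $U$ is open in $X$ and $f^{-1}(y)\subseteq U$, then $y\in\operatorname{Int}\big(\overline{f(U)}\big)$. *)

theory Defs
  imports "HOL-Analysis.Analysis"
begin

(* completely_regular_space does not include any separation axiom on points. *)
definition tychonoff_space :: "'a topology \<Rightarrow> bool"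
  where "tychonoff_space X \<longleftrightarrow> completely_regular_space X \<and> Hausdorff_space X"

(* The Greek letter in the name is written out; there is no cardinal parameter. Continuity is
   not part of the definition: it is a separate hypothesis wherever it is needed. *)
definition kappa_pseudo_open_map :: "'a topology \<Rightarrow> 'b topology \<Rightarrow> ('a \<Rightarrow> 'b) \<Rightarrow> bool"
  where "kappa_pseudo_open_map X Y f \<longleftrightarrow>
    (\<forall>y \<in> topspace Y. \<forall>U. openin X U \<and> {x \<in> topspace X. f x = y} \<subseteq> U
        \<longrightarrow> y \<in> Y interior_of (Y closure_of (f ` U)))"

end

theory Submission
  imports Defs
begin

text \<open>
  The proof passes to complements. If the fibre over \<open>y\<close> misses the closure of the preimage
  of \<open>U\<close>, then the complement of that closure is an open neighbourhood of the fibre whose image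
  misses \<open>U\<close>, so (i) keeps \<open>y\<close> out of the closure of \<open>U\<close>. Conversely, if (i) fails at
  \<open>y\<close> and \<open>W\<close>, then \<open>y\<close> lies in the closure of the open set
  \<open>U = Y - cl (f W)\<close>, and (ii) yields a point of \<open>W\<close> in the closure of the preimage of \<open>U\<close>,
  although \<open>f W\<close> and \<open>U\<close> are disjoint.
\<close>

lemma kappa_pseudo_open_map_fibre_meets_closure:
  assumes f: "kappa_pseudo_open_map X Y f"
    and U: "openin Y U" and y: "y \<in> Y closure_of U"
  shows "{x \<in> topspace X. f x = y} \<inter> X closure_of {x \<in> topspace X. f x \<in> U} \<noteq> {}"
proof
  let ?C = "X closure_of {x \<in> topspace X. f x \<in> U}"
  let ?W = "topspace X - ?C"
  assume disj: "{x \<in> topspace X. f x = y} \<inter> ?C = {}"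
  have "y \<in> topspace Y"
    using y closure_of_subset_topspace by fastforce
  moreover have "openin X ?W"
    by (simp add: openin_diff)
  moreover have "{x \<in> topspace X. f x = y} \<subseteq> ?W"
    using disj by blast
  ultimately have "y \<in> Y interior_of (Y closure_of (f ` ?W))"
    using f unfolding kappa_pseudo_open_map_def by blast
  \<comment> \<open>The interior is an open neighbourhood of \<open>y\<close>, and \<open>y\<close>
    is in the closure of \<open>U\<close>, so the two sets share a point \<open>z\<close>. Then
    \<open>U\<close> is itself a neighbourhood of \<open>z\<close> and must meet the image of
    \<open>?W\<close>.\<close>
  then obtain z where z: "z \<in> U" "z \<in> Y closure_of (f ` ?W)"
    using y interior_of_subset[of Y "Y closure_of (f ` ?W)"]
      openin_interior_of[of Y "Y closure_of (f ` ?W)"]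
    unfolding in_closure_of[of y] by blast
  then obtain w where "w \<in> ?W" "f w \<in> U"
    using U by (force simp: in_closure_of)
  moreover have "{x \<in> topspace X. f x \<in> U} \<subseteq> ?C"
    by (rule closure_of_subset) blast
  ultimately show False
    by blast
qed

lemma kappa_pseudo_open_map_if_closure_lifts:
  assumes "\<And>U. openin Y U \<Longrightarrow>
      Y closure_of U \<subseteq> f ` (X closure_of {x \<in> topspace X. f x \<in> U})"
    and f: "f ` topspace X \<subseteq> topspace Y"
  shows "kappa_pseudo_open_map X Y f"
  unfolding kappa_pseudo_open_map_def
proof (intro ballI allI impI, elim conjE)
  fix y W
  assume y: "y \<in> topspace Y" and W: "openin X W"
    and fibre: "{x \<in> topspace X. f x = y} \<subseteq> W"
  let ?U = "topspace Y - Y closure_of (f ` W)"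
  show "y \<in> Y interior_of (Y closure_of (f ` W))"
  proof (rule ccontr)
    assume "y \<notin> Y interior_of (Y closure_of (f ` W))"
    then have "y \<in> Y closure_of ?U"
      using y by (simp add: closure_of_complement)
    moreover have "openin Y ?U"
      by (simp add: openin_diff)
    ultimately obtain x where x: "x \<in> X closure_of {x \<in> topspace X. f x \<in> ?U}" "y = f x"
      using assms(1) by blast
    \<comment> \<open>Since \<open>x\<close> lies over \<open>y\<close>, the fibre hypothesis makes
      \<open>W\<close> a neighbourhood of \<open>x\<close>, so \<open>W\<close> meets the preimage
      of \<open>?U\<close>.\<close>
    then have "x \<in> W"
      using fibre by (auto simp: in_closure_of)
    then obtain w where "w \<in> W" "f w \<in> ?U"
      using x W by (auto simp: in_closure_of)
    moreover have "f ` W \<subseteq> Y closure_of (f ` W)"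
      using f openin_subset[OF W] by (intro closure_of_subset) blast
    ultimately show False
      by blast
  qed
qed

text \<open>Continuity gives one inclusion. For the other, surjectivity lifts the points of
  \<open>U\<close>, and \<open>fibre\<close> lifts the remaining points of its closure.\<close>

lemma closure_of_eq_image_closure_of_preimage:
  assumes cont: "continuous_map X Y f" and surj: "f ` topspace X = topspace Y"
    and U: "openin Y U"
    and fibre: "\<And>y. y \<in> Y closure_of U - U \<Longrightarrow>
      {x \<in> topspace X. f x = y} \<inter> X closure_of {x \<in> topspace X. f x \<in> U} \<noteq> {}"
  shows "Y closure_of U = f ` (X closure_of {x \<in> topspace X. f x \<in> U})"
    (is "_ = f ` (X closure_of ?P)")
proof
  have "f ` (X closure_of ?P) \<subseteq> Y closure_of (f ` ?P)"
    using cont by (rule continuous_map_image_closure_subset)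
  also have "\<dots> \<subseteq> Y closure_of U"
    by (rule closure_of_mono) blast
  finally show "f ` (X closure_of ?P) \<subseteq> Y closure_of U" .
next
  have "U \<subseteq> f ` ?P"
    using surj openin_subset[OF U] by force
  moreover have "?P \<subseteq> X closure_of ?P"
    by (rule closure_of_subset) blast
  ultimately have "U \<subseteq> f ` (X closure_of ?P)"
    by blast
  then show "Y closure_of U \<subseteq> f ` (X closure_of ?P)"
    using fibre by blast
qed

theorem lemma4p1:
  fixes X :: "'a topology" and Y :: "'b topology" and f :: "'a \<Rightarrow> 'b"
  assumes "tychonoff_space X" and "tychonoff_space Y"
    and "continuous_map X Y f" and "f ` topspace X = topspace Y"
  shows "(kappa_pseudo_open_map X Y f \<longleftrightarrow>
            (\<forall>U. openin Y U \<longrightarrow>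
              Y closure_of U = f ` (X closure_of {x \<in> topspace X. f x \<in> U})))
       \<and> ((\<forall>U. openin Y U \<longrightarrow>
              Y closure_of U = f ` (X closure_of {x \<in> topspace X. f x \<in> U})) \<longleftrightarrow>
          (\<forall>U. openin Y U \<and> \<not> closedin Y U \<longrightarrow>
              (\<forall>y \<in> (Y closure_of U) - U.
                {x \<in> topspace X. f x = y} \<inter> (X closure_of {x \<in> topspace X. f x \<in> U}) \<noteq> {})))"
proof -
  let ?lift = "\<forall>U. openin Y U \<longrightarrow>
    Y closure_of U = f ` (X closure_of {x \<in> topspace X. f x \<in> U})"
  let ?fib = "\<forall>U. openin Y U \<and> \<not> closedin Y U \<longrightarrow>
    (\<forall>y \<in> (Y closure_of U) - U.
      {x \<in> topspace X. f x = y} \<inter> (X closure_of {x \<in> topspace X. f x \<in> U}) \<noteq> {})"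
  \<comment> \<open>The equivalences follow from the cycle (i) to (iii) to (ii) to (i).\<close>
  have "?fib" if "kappa_pseudo_open_map X Y f"
    using kappa_pseudo_open_map_fibre_meets_closure[OF that] by (intro allI impI ballI) auto
  moreover have "?lift" if fib: "?fib"
  proof (intro allI impI)
    fix U
    assume U: "openin Y U"
    show "Y closure_of U = f ` (X closure_of {x \<in> topspace X. f x \<in> U})"
    proof (rule closure_of_eq_image_closure_of_preimage[OF assms(3,4) U])
      fix y
      assume y: "y \<in> Y closure_of U - U"
      \<comment> \<open>A closed \<open>U\<close> equals its closure and leaves no such
        \<open>y\<close>, so restricting (iii) to non-closed sets loses nothing.\<close>
      then have "\<not> closedin Y U"
        by (auto simp: closure_of_closedin)
      then show "{x \<in> topspace X. f x = y} \<inter> X closure_of {x \<in> topspace X. f x \<in> U} \<noteq> {}"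
        using fib U y by simp
    qed
  qed
  moreover have "kappa_pseudo_open_map X Y f" if "?lift"
    using that assms(4) by (intro kappa_pseudo_open_map_if_closure_lifts) auto
  ultimately show ?thesis
    by argo
qed

end
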